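(* For every positive integer $n$: (1) if $2n-1\leq t\leq 4n-3$, then $K_{2n-1}\in\mathfrak{T}_t$; (2) if $3n\leq t\leq 4n-1$, then $K_{2n}\in\mathfrak{T}_t$.
   Context: All graphs are finite, undirected, without loops or multiple edges; $K_m$ is the complete graph on $m$ vertices. A total coloring of a graph $G$ is an assignment of colors to the vertices and edges of $G$ such that no two adjacent vertices, no two adjacent edges, and no vertex and an edge incident to it receive the same color. For a positive integer $t$, an interval total $t$-coloring of $G$ is a total coloring of $G$ with colors $1,2,\ldots,t$ such that each color $i\in\{1,\ldots,t\}$ is used on at least one vertex or edge, and for each vertex $v$ the set consisting of the color of $v$ and the colors of the edges incident to $v$ consists of $d_G(v)+1$ consecutive integers, where $d_G(v)$ is the degree of $v$. $\mathfrak{T}_t$ denotes the set of graphs having an interval total $t$-coloring. *)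

theory Defs
  imports "Graph_Theory.Kuratowski"
begin

text \<open>
  The library represents a finite simple graph (locale \<open>graph\<close>) as a symmetric digraph, with one
  arc for each orientation of an edge.  Since a total coloring assigns one color to each undirected
  edge, the undirected edges are recovered here as the sets of their two ends.
\<close>

definition uedges :: "('a, 'b) pre_digraph \<Rightarrow> 'a set set" where
  "uedges G = {{u, v} | u v. u \<rightarrow>\<^bsub>G\<^esub> v}"

definition incident_uedges :: "('a, 'b) pre_digraph \<Rightarrow> 'a \<Rightarrow> 'a set set" where
  "incident_uedges G v = {e \<in> uedges G. v \<in> e}"

definition udegree :: "('a, 'b) pre_digraph \<Rightarrow> 'a \<Rightarrow> nat" where
  "udegree G v = card (incident_uedges G v)"

text \<open>The coloring is given by its restrictions \<open>\<alpha>\<close> to the vertices and \<open>\<beta>\<close> to the edges.\<close>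

definition total_coloring ::
  "('a, 'b) pre_digraph \<Rightarrow> ('a \<Rightarrow> 'c) \<Rightarrow> ('a set \<Rightarrow> 'c) \<Rightarrow> bool" where
  "total_coloring G \<alpha> \<beta> \<longleftrightarrow>
     (\<forall>u v. u \<rightarrow>\<^bsub>G\<^esub> v \<longrightarrow> \<alpha> u \<noteq> \<alpha> v) \<and>
     (\<forall>e \<in> uedges G. \<forall>f \<in> uedges G. e \<noteq> f \<and> e \<inter> f \<noteq> {} \<longrightarrow> \<beta> e \<noteq> \<beta> f) \<and>
     (\<forall>v \<in> verts G. \<forall>e \<in> incident_uedges G v. \<alpha> v \<noteq> \<beta> e)"

definition interval_total_coloring ::
  "('a, 'b) pre_digraph \<Rightarrow> nat \<Rightarrow> ('a \<Rightarrow> nat) \<Rightarrow> ('a set \<Rightarrow> nat) \<Rightarrow> bool" where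
  "interval_total_coloring G t \<alpha> \<beta> \<longleftrightarrow>
     total_coloring G \<alpha> \<beta> \<and>
     \<alpha> ` verts G \<union> \<beta> ` uedges G = {1..t} \<and>
     (\<forall>v \<in> verts G. \<exists>a. insert (\<alpha> v) (\<beta> ` incident_uedges G v) = {a..<a + (udegree G v + 1)})"

definition interval_total_colorable :: "nat \<Rightarrow> ('a, 'b) pre_digraph set" (\<open>\<TT>\<^bsub>_\<^esub>\<close>) where
  "\<TT>\<^bsub>t\<^esub> = {G. graph G \<and> 0 < t \<and> (\<exists>\<alpha> \<beta>. interval_total_coloring G t \<alpha> \<beta>)}"

end

theory Submission
  imports Defs
begin

text \<open>
  A total coloring of a complete graph is a symmetric array with vertex colors on the diagonal.
  For odd \<open>m\<close> the array \<open>i + j\<close>, with the values \<open>\<ge> t\<close> lowered by \<open>m\<close>, uses exactly \<open>t\<close> colors;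
  oddness keeps the diagonal \<open>2 i\<close> distinct modulo \<open>m\<close>.
  Replacing every entry \<open>c\<close> by the block with rows \<open>c, c + m\<close> and \<open>c + m, c + 2 m\<close> turns \<open>t\<close> colors
  on \<open>m\<close> vertices into \<open>t + 2 m\<close> colors on \<open>2 m\<close> vertices.  This settles \<open>2 n\<close> vertices for odd \<open>n\<close>,
  and for \<open>n = 2 k\<close> it reduces \<open>t \<ge> 7 k\<close> to \<open>n\<close> vertices.

  In the remaining case \<open>n = 2 k\<close>, \<open>t = 6 k + l\<close> with \<open>l < k\<close>, take vertices \<open>(i, s)\<close> with \<open>i < n\<close> and
  \<open>s\<close> boolean, and color the edges so that \<open>(i, False)\<close> and \<open>(i, True)\<close> see the same \<open>2 n - 1\<close>
  consecutive colors, starting at a value strictly increasing in \<open>i\<close>; then \<open>(i, False)\<close> gets the color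
  just below this interval and \<open>(i, True)\<close> the one just above.  Edges inside a copy (and the edge between
  the two copies of \<open>i\<close>) are colored by a strictly increasing function of \<open>i + j\<close> that skips three zones
  of \<open>l\<close>, \<open>n - 1 - l\<close> and \<open>l\<close> colors.  The skipped colors decompose the other edges between the
  copies: the middle ones are perfect matchings, the low ones live on the indices below \<open>k\<close> only,
  and the high ones on those from \<open>k\<close> on.
\<close>

section \<open>Interval arrays and change of index set\<close>

text \<open>Colors are counted from \<open>0\<close> here; \<open>a u\<close> is the least color at \<open>u\<close>.\<close>

definition interval_array :: "'v set \<Rightarrow> ('v \<Rightarrow> nat) \<Rightarrow> nat \<Rightarrow> ('v \<Rightarrow> 'v \<Rightarrow> nat) \<Rightarrow> bool" where
  "interval_array V a t M \<longleftrightarrow>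
     (\<forall>u\<in>V. \<forall>v\<in>V. M u v = M v u) \<and> inj_on (\<lambda>u. M u u) V \<and>
     (\<forall>u\<in>V. inj_on (M u) V) \<and>
     (\<forall>u\<in>V. \<forall>v\<in>V. a u \<le> M u v \<and> M u v < a u + card V) \<and>
     (\<Union>u\<in>V. {a u..<a u + card V}) = {..<t}"

definition has_interval_array :: "nat \<Rightarrow> nat \<Rightarrow> bool" where
  "has_interval_array m t \<longleftrightarrow> (\<exists>a M. interval_array {..<m} a t M)"

text \<open>Arrays are built on numbers or pairs but used on the vertices of an arbitrary graph;
  only the size of the index set matters.\<close>

lemma interval_array_transport:
  assumes M: "interval_array V a t M" and h: "bij_betw h W V"
  shows "interval_array W (\<lambda>u. a (h u)) t (\<lambda>u v. M (h u) (h v))"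
proof -
  have inj: "inj_on h W" and im: "h ` W = V" and card: "card W = card V"
    using h by (auto simp: bij_betw_def bij_betw_same_card[OF h])
  have mem: "h u \<in> V" if "u \<in> W" for u
    using that im by auto
  have "inj_on ((\<lambda>u. M u u) \<circ> h) W"
    using M inj im by (intro comp_inj_on) (auto simp: interval_array_def)
  moreover have "inj_on (M (h u) \<circ> h) W" if "u \<in> W" for u
    using M inj im that by (intro comp_inj_on) (auto simp: interval_array_def)
  moreover have "(\<Union>u\<in>W. {a (h u)..<a (h u) + card V}) = (\<Union>u\<in>V. {a u..<a u + card V})"
    using im by blast
  ultimately show ?thesis
    using M mem by (auto simp: interval_array_def card comp_def)
qed

lemma has_interval_arrayI:
  assumes "interval_array V a t M" "finite V" "card V = m"
  shows "has_interval_array m t"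
proof -
  obtain h where "bij_betw h {..<m} V"
    using ex_bij_betw_nat_finite[OF assms(2)] assms(3) by (auto simp: lessThan_atLeast0)
  then show ?thesis
    unfolding has_interval_array_def using interval_array_transport[OF assms(1)] by blast
qed

lemma has_interval_arrayE:
  assumes "has_interval_array m t" "finite V" "card V = m"
  obtains a M where "interval_array V a t M"
proof -
  obtain h where "bij_betw h V {..<m}"
    using ex_bij_betw_finite_nat[OF assms(2)] assms(3) by (auto simp: lessThan_atLeast0)
  then show ?thesis
    using assms(1) interval_array_transport that unfolding has_interval_array_def by blast
qed

lemma interval_array_row:
  assumes "interval_array V a t M" "finite V" "u \<in> V"
  shows "M u ` V = {a u..<a u + card V}"
proof (rule card_subset_eq)
  show "M u ` V \<subseteq> {a u..<a u + card V}"
    using assms by (auto simp: interval_array_def)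
  have "inj_on (M u) V"
    using assms by (auto simp: interval_array_def)
  then show "card (M u ` V) = card {a u..<a u + card V}"
    by (simp add: card_image)
qed simp

section \<open>Odd orders and doubling\<close>

lemma has_interval_array_odd:
  assumes "odd m" "m \<le> t" "t < 2 * m"
  shows "has_interval_array m t"
proof -
  define M where "M i j = (if i + j < t then i + j else i + j - m)" for i j :: nat
  \<comment> \<open>If \<open>i + m > t\<close>, the values \<open>t, ..., i + m - 1\<close> of row
    \<open>i\<close> drop to \<open>t - m, ..., i - 1\<close>, so the row fills the last
    \<open>m\<close> colors.\<close>
  define a where "a i = (if i + m \<le> t then i else t - m)" for i
  have "interval_array {..<m} a t M"
    unfolding interval_array_def card_lessThan
  proof (intro conjI ballI)
    fix i j
    show "M i j = M j i"
      by (simp add: M_def add.commute)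
    assume "i \<in> {..<m}" "j \<in> {..<m}"
    then show "a i \<le> M i j" "M i j < a i + m"
      using assms(2,3) unfolding M_def a_def lessThan_iff
      by (cases "i + m \<le> t"; cases "i + j < t"; simp; linarith)+
  next
    show "inj_on (\<lambda>i. M i i) {..<m}"
    proof (rule inj_onI)
      fix i j assume "M i i = M j j"
      then have "i + i = j + j \<or> i + i = j + j + m \<or> j + j = i + i + m"
        using assms(2) unfolding M_def by (cases "i + i < t"; cases "j + j < t"; simp; linarith)
      with assms(1) show "i = j"
        by presburger
    qed
  next
    fix i
    show "inj_on (M i) {..<m}"
    proof (rule inj_onI)
      fix j l assume "j \<in> {..<m}" "l \<in> {..<m}" "M i j = M i l"
      then show "j = l"
        using assms(2) unfolding M_def lessThan_iff by (simp split: if_splits)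
    qed
  next
    show "(\<Union>i\<in>{..<m}. {a i..<a i + m}) = {..<t}"
    proof (intro equalityI subsetI)
      fix x assume "x \<in> {..<t}"
      \<comment> \<open>The first and the last interval suffice, since \<open>t < 2 * m\<close>
        leaves no hole between them.\<close>
      then have "x \<in> {a 0..<a 0 + m} \<or> x \<in> {a (t - m)..<a (t - m) + m}"
        using assms(2,3) by (auto simp: a_def)
      moreover have "0 < m" "t - m < m" using assms by auto
      ultimately show "x \<in> (\<Union>i\<in>{..<m}. {a i..<a i + m})" by blast
    next
      fix x assume "x \<in> (\<Union>i\<in>{..<m}. {a i..<a i + m})"
      then show "x \<in> {..<t}"
        using assms(2) by (auto simp: a_def split: if_splits)
    qed
  qed
  then show ?thesis
    unfolding has_interval_array_def by blast
qed

text \<open>Row \<open>(u, s)\<close> consists of row \<open>u\<close> shifted by \<open>s m\<close>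
  and by \<open>(s + 1) m\<close>, which lie in adjacent intervals of length \<open>m\<close>.
  Diagonal shifts are \<open>0\<close> and \<open>2 m\<close>, so \<open>t \<le> 2 * m\<close> keeps
  the vertex colors of the two copies apart.\<close>

lemma has_interval_array_double:
  assumes "has_interval_array m t" "0 < t" "t \<le> 2 * m"
  shows "has_interval_array (2 * m) (t + 2 * m)"
proof -
  obtain a M where M: "interval_array {..<m} a t M"
    using assms(1) unfolding has_interval_array_def by blast
  have lt: "a u + m \<le> t" if "u < m" for u
  proof -
    have "a u + m - 1 \<in> (\<Union>u\<in>{..<m}. {a u..<a u + m})"
      using that by force
    then have "a u + m - 1 \<in> {..<t}"
      using M by (simp only: interval_array_def card_lessThan)
    then show ?thesis using that by auto
  qed
  have row: "a u \<le> M u v" "M u v < a u + m" if "u < m" "v < m" for u v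
    using M that by (auto simp: interval_array_def)
  define V where "V = {..<m} \<times> {..<2::nat}"
  define M' where "M' x y = M (fst x) (fst y) + (snd x + snd y) * m" for x y :: "nat \<times> nat"
  define a' where "a' x = a (fst x) + snd x * m" for x :: "nat \<times> nat"
  have card: "card V = 2 * m" by (simp add: V_def)
  have two: "d = 0 \<or> d = 1" if "d < 2" for d :: nat
    using that by auto
  have "interval_array V a' (t + 2 * m) M'"
    unfolding interval_array_def card
  proof (intro conjI ballI)
    fix x y assume "x \<in> V" "y \<in> V"
    then show "M' x y = M' y x"
      using M by (auto simp: V_def M'_def interval_array_def)
  next
    fix x y assume "x \<in> V" "y \<in> V"
    then show "a' x \<le> M' x y" "M' x y < a' x + 2 * m"
      using row[of "fst x" "fst y"] by (auto simp: V_def M'_def a'_def dest!: two)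
  next
    show "inj_on (\<lambda>x. M' x x) V"
    proof (rule inj_onI)
      fix x y assume xy: "x \<in> V" "y \<in> V" and eq: "M' x x = M' y y"
      have "M (fst x) (fst x) < 2 * m" "M (fst y) (fst y) < 2 * m"
        using xy row[of "fst x" "fst x"] row[of "fst y" "fst y"] lt[of "fst x"] lt[of "fst y"] assms
        by (auto simp: V_def)
      then have "snd x = snd y" "M (fst x) (fst x) = M (fst y) (fst y)"
        using xy eq by (auto simp: V_def M'_def dest!: two)
      then show "x = y"
        using M xy by (auto simp: V_def interval_array_def inj_on_def)
    qed
  next
    fix x assume x: "x \<in> V"
    show "inj_on (M' x) V"
    proof (rule inj_onI)
      fix y z assume yz: "y \<in> V" "z \<in> V" and eq: "M' x y = M' x z"
      then have "snd y = snd z" "M (fst x) (fst y) = M (fst x) (fst z)"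
        using x row[of "fst x" "fst y"] row[of "fst x" "fst z"]
        by (auto simp: V_def M'_def dest!: two)
      then show "y = z"
        using M x yz by (auto simp: V_def interval_array_def inj_on_def)
    qed
  next
    have un: "\<exists>u<m. a u \<le> x \<and> x < a u + m" if "x < t" for x
    proof -
      have "x \<in> (\<Union>u\<in>{..<m}. {a u..<a u + m})"
        using that M by (simp only: interval_array_def card_lessThan lessThan_iff)
      then show ?thesis by auto
    qed
    show "(\<Union>x\<in>V. {a' x..<a' x + 2 * m}) = {..<t + 2 * m}"
    proof (intro equalityI subsetI)
      fix x assume "x \<in> (\<Union>x\<in>V. {a' x..<a' x + 2 * m})"
      then show "x \<in> {..<t + 2 * m}"
        using lt by (force simp: V_def a'_def dest!: two)
    next
      fix x assume "x \<in> {..<t + 2 * m}"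
      then have x: "x < t + 2 * m" by simp
      show "x \<in> (\<Union>x\<in>V. {a' x..<a' x + 2 * m})"
      proof (cases "2 * m \<le> x")
        case True
        then have "x - 2 * m < t" using x by linarith
        then obtain u where "u < m" "a u \<le> x - 2 * m" "x - 2 * m < a u + m"
          using un by blast
        then have "(u, 1) \<in> V" "x \<in> {a' (u, 1)..<a' (u, 1) + 2 * m}"
          using True by (auto simp: V_def a'_def)
        then show ?thesis by blast
      next
        case False
        \<comment> \<open>Only \<open>a u \<le> x\<close> is at stake, as \<open>x < 2 * m\<close>;
          capping at \<open>t - 1\<close> yields a color to which \<open>un\<close> applies.\<close>
        have "min x (t - 1) < t" using assms(2) by linarith
        then obtain u where "u < m" "a u \<le> min x (t - 1)" "min x (t - 1) < a u + m"
          using un by blast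
        then have "(u, 0) \<in> V" "x \<in> {a' (u, 0)..<a' (u, 0) + 2 * m}"
          using False x by (auto simp: V_def a'_def)
        then show ?thesis by blast
      qed
    qed
  qed
  then show ?thesis
    by (rule has_interval_arrayI) (simp_all add: V_def)
qed

section \<open>Direct construction on \<open>4 k\<close> vertices\<close>

text \<open>The skipped zones are \<open>k + 1..k + l\<close>, \<open>2 k + l + 1..4 k - 1\<close>
  and \<open>5 k - 1..5 k + l - 2\<close>. Values start at \<open>1\<close> because color
  \<open>0\<close> is reserved for the vertex \<open>(0, False)\<close>.\<close>

definition gap :: "nat \<Rightarrow> nat \<Rightarrow> nat \<Rightarrow> nat" where
  "gap k l x = (if x < k then x + 1 else if x < 2 * k then x + l + 1
      else if x + 1 < 3 * k then x + 2 * k else x + 2 * k + l)"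

text \<open>
  Within a half of the indices, \<open>d\<close> is \<open>i - j\<close> modulo \<open>k\<close>: the differences \<open>1, \<dots>, l\<close> form the low
  and high zones.
\<close>

definition cross :: "nat \<Rightarrow> nat \<Rightarrow> nat \<Rightarrow> nat \<Rightarrow> nat" where
  "cross k l i j =
    (if (i < k) = (j < k)
     then let d = (if j \<le> i then i - j else i + k - j)
          in if l < d then 2 * k + d else if i < k then k + d else 5 * k + d - 2
     else if i + j < 2 * k then 2 * k + i + j else k + i + j)"

lemma gap_inj:
  assumes "l < k" "gap k l x = gap k l y"
  shows "x = y"
  using assms unfolding gap_def by (simp split: if_splits)

text \<open>The \<open>4 k - 1\<close> edges at \<open>(i, s)\<close> are to use the colors from
  \<open>gap k l i\<close> on, hence the \<open>+ 1\<close> in the strict bound.\<close>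

lemma gap_bounds:
  assumes "l < k" "i < 2 * k" "j < 2 * k"
  shows "gap k l i \<le> gap k l (i + j)" "gap k l (i + j) + 1 < gap k l i + 4 * k"
  using assms unfolding gap_def by simp_all

text \<open>Replaces arithmetic modulo \<open>k\<close> by linear alternatives that
  \<open>linarith\<close> can decide. In the swap cases the color is
  \<open>3 k + (i + j) mod k\<close>.\<close>

lemma cross_cases:
  assumes "l < k" "i < 2 * k" "j < 2 * k" "i \<noteq> j"
  obtains (low) d where "0 < d" "d \<le> l" "i = j + d \<or> i + k = j + d" "i < k" "j < k" "cross k l i j = k + d"
  | (high) d where "0 < d" "d \<le> l" "i = j + d \<or> i + k = j + d" "k \<le> i" "k \<le> j" "cross k l i j + 2 = 5 * k + d"
  | (mid) d where "l < d" "d < k" "i = j + d \<or> i + k = j + d" "i < k \<and> j < k \<or> k \<le> i \<and> k \<le> j" "cross k l i j = 2 * k + d"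
  | (swap1) "i < k \<and> k \<le> j \<or> k \<le> i \<and> j < k" "i + j < 2 * k" "cross k l i j = 2 * k + i + j"
  | (swap2) "i < k \<and> k \<le> j \<or> k \<le> i \<and> j < k" "2 * k \<le> i + j" "cross k l i j = k + i + j"
proof (cases "(i < k) = (j < k)")
  case True
  define d where "d = (if j \<le> i then i - j else i + k - j)"
  have d: "0 < d" "d < k" "i = j + d \<or> i + k = j + d"
    using assms True unfolding d_def by (simp_all split: if_split) linarith+
  have "cross k l i j = (if l < d then 2 * k + d else if i < k then k + d else 5 * k + d - 2)"
    using True by (simp add: cross_def d_def Let_def)
  then show ?thesis
    using low[of d] high[of d] mid[of d] d True assms(1) by (simp split: if_splits) linarith+
next
  case False
  then show ?thesis
    using swap1 swap2 by (simp add: cross_def split: if_splits) linarith+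
qed

text \<open>Every edge interval contains the middle zone; the low zone fits those of indices below
  \<open>k\<close>, the high zone those from \<open>k\<close> on. Low and high colors only join
  indices of the same half.\<close>

lemma cross_bounds:
  assumes "l < k" "i < 2 * k" "j < 2 * k" "i \<noteq> j"
  shows "gap k l i \<le> cross k l i j" "cross k l i j + 1 < gap k l i + 4 * k"
     "gap k l j \<le> cross k l i j" "cross k l i j + 1 < gap k l j + 4 * k"
  using assms by (cases rule: cross_cases[OF assms]; simp add: gap_def; linarith)+

lemma cross_neq_gap:
  assumes "l < k" "i < 2 * k" "j < 2 * k" "i \<noteq> j"
  shows "cross k l i j \<noteq> gap k l x"
  using assms by (cases rule: cross_cases[OF assms]) (simp add: gap_def; linarith)+

text \<open>The color fixes the zone and then \<open>i - j\<close> or \<open>i + j\<close> modulo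
  \<open>k\<close>, hence \<open>j\<close>. Since \<open>cross\<close> is not symmetric, the other
  argument needs its own lemma.\<close>

lemma cross_inj1:
  assumes "l < k" "i < 2 * k" "j < 2 * k" "i \<noteq> j" "j' < 2 * k" "i \<noteq> j'" "cross k l i j = cross k l i j'"
  shows "j = j'"
  using assms(7)
  by (cases rule: cross_cases[OF assms(1-4)]; cases rule: cross_cases[OF assms(1,2,5,6)]) (use assms in linarith)+

lemma cross_inj2:
  assumes "l < k" "j < 2 * k" "i < 2 * k" "j \<noteq> i" "j' < 2 * k" "j' \<noteq> i" "cross k l j i = cross k l j' i"
  shows "j = j'"
  using assms(7)
  by (cases rule: cross_cases[OF assms(1-4)]; cases rule: cross_cases[OF assms(1,5,3,6)]) (use assms in linarith)+

lemma has_interval_array_short: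
  assumes l: "l < k"
  shows "has_interval_array (4 * k) (6 * k + l)"
proof -
  define V where "V = {..<2 * k} \<times> (UNIV :: bool set)"
  \<comment> \<open>The edge between the two copies of \<open>i\<close> supplies the sum
    \<open>i + i\<close>, which no other vertex of the same copy gives. The first argument of
    \<open>cross\<close> is always the index in the \<open>False\<close> copy, which makes
    \<open>M\<close> symmetric.\<close>
  define M where "M x y =
    (if x = y then gap k l (fst x) - 1 + (if snd x then 4 * k else 0)
     else if snd x = snd y \<or> fst x = fst y then gap k l (fst x + fst y)
     else if snd x then cross k l (fst y) (fst x) else cross k l (fst x) (fst y))"
    for x y :: "nat \<times> bool"
  define a where "a x = gap k l (fst x) - (if snd x then 0 else 1)" for x :: "nat \<times> bool"
  have card: "card V = 4 * k" by (simp add: V_def)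
  have pos: "0 < gap k l i" for i
    using l by (simp add: gap_def)
  have gap_less: "gap k l i \<le> k + k + l" if "i < 2 * k" for i
    using that l by (simp add: gap_def)
  have edge: "gap k l (fst x) \<le> M x y" "M x y + 1 < gap k l (fst x) + 4 * k"
    if "x \<in> V" "y \<in> V" "x \<noteq> y" for x y
    using that gap_bounds[OF l, of "fst x" "fst y"]
      cross_bounds[OF l, of "fst x" "fst y"] cross_bounds[OF l, of "fst y" "fst x"]
    by (auto simp: V_def M_def)
  have "interval_array V a (6 * k + l) M"
    unfolding interval_array_def card
  proof (intro conjI ballI)
    fix x y assume "x \<in> V" "y \<in> V"
    then show "M x y = M y x"
      by (auto simp: M_def add.commute)
  next
    fix x y assume xy: "x \<in> V" "y \<in> V"
    show "a x \<le> M x y" "M x y < a x + 4 * k"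
      using edge[OF xy] pos[of "fst x"] xy by (cases "x = y"; auto simp: M_def a_def V_def)+
  next
    show "inj_on (\<lambda>x. M x x) V"
    proof (rule inj_onI)
      fix x y assume xy: "x \<in> V" "y \<in> V" and eq: "M x x = M y y"
      have "fst x < 2 * k" "fst y < 2 * k" using xy by (auto simp: V_def)
      \<comment> \<open>Vertex colors lie below \<open>4 k\<close> exactly in the
        \<open>False\<close> copy.\<close>
      then have "snd x = snd y" "gap k l (fst x) = gap k l (fst y)"
        using eq l gap_less[of "fst x"] gap_less[of "fst y"] pos[of "fst x"] pos[of "fst y"]
        by (auto simp: M_def split: if_splits)
      then show "x = y"
        using gap_inj[OF l] by (simp add: prod_eq_iff)
    qed
  next
    fix x assume x: "x \<in> V"
    have diag: "M x x < gap k l (fst x) \<or> gap k l (fst x) + 4 * k \<le> M x x + 1"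
      using pos[of "fst x"] by (auto simp: M_def)
    show "inj_on (M x) V"
    proof (rule inj_onI)
      fix y z assume yz: "y \<in> V" "z \<in> V" and eq: "M x y = M x z"
      show "y = z"
      proof (cases "x = y \<or> x = z")
        case True
        then show ?thesis
          using edge[OF x yz(1)] edge[OF x yz(2)] diag eq by fastforce
      next
        case False
        have lt: "fst x < 2 * k" "fst y < 2 * k" "fst z < 2 * k"
          using x yz by (auto simp: V_def)
        define c where "c j = (if snd x then cross k l j (fst x) else cross k l (fst x) j)" for j
        have c_inj: "p = q" if "p < 2 * k" "q < 2 * k" "p \<noteq> fst x" "q \<noteq> fst x" "c p = c q" for p q
          using that lt(1) cross_inj1[OF l lt(1), of p q] cross_inj2[OF l _ lt(1), of p q]
          by (auto simp: c_def split: if_splits)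
        have c_gap: "c p \<noteq> gap k l u" if "p < 2 * k" "p \<noteq> fst x" for p u
          using that lt(1) cross_neq_gap[OF l] by (auto simp: c_def)
        have M_c: "M x w = (if snd w = snd x \<or> fst w = fst x then gap k l (fst x + fst w) else c (fst w))"
          if "x \<noteq> w" for w
          using that by (auto simp: M_def c_def)
        have "fst y = fst z \<and> snd y = snd z"
        proof (cases "snd y = snd x \<or> fst y = fst x"; cases "snd z = snd x \<or> fst z = fst x")
          assume y: "snd y = snd x \<or> fst y = fst x" and z: "snd z = snd x \<or> fst z = fst x"
          then have "gap k l (fst x + fst y) = gap k l (fst x + fst z)"
            using eq False by (simp add: M_c)
          \<comment> \<open>Equal sums give equal indices. If this index is \<open>fst x\<close>,
            both vertices are the other copy of \<open>x\<close>; otherwise both lie in the copy of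
            \<open>x\<close>.\<close>
          from gap_inj[OF l this] show ?thesis
            using y z False by (auto simp: prod_eq_iff)
        next
          assume "snd y = snd x \<or> fst y = fst x" "\<not> (snd z = snd x \<or> fst z = fst x)"
          then show ?thesis
            using eq False c_gap[OF lt(3)] by (simp add: M_c) metis
        next
          assume "\<not> (snd y = snd x \<or> fst y = fst x)" "snd z = snd x \<or> fst z = fst x"
          then show ?thesis
            using eq False c_gap[OF lt(2)] by (simp add: M_c)
        next
          assume "\<not> (snd y = snd x \<or> fst y = fst x)" "\<not> (snd z = snd x \<or> fst z = fst x)"
          then show ?thesis
            using eq False c_inj[OF lt(2,3)] by (auto simp: M_c)
        qed
        then show ?thesis
          by (simp add: prod_eq_iff)
      qed
    qed
  next
    show "(\<Union>x\<in>V. {a x..<a x + 4 * k}) = {..<6 * k + l}"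
    proof (intro equalityI subsetI)
      fix c assume "c \<in> (\<Union>x\<in>V. {a x..<a x + 4 * k})"
      then show "c \<in> {..<6 * k + l}"
        using gap_less by (force simp: V_def a_def)
    next
      fix c assume c: "c \<in> {..<6 * k + l}"
      \<comment> \<open>The lowest and the highest interval overlap and together contain all
        colors.\<close>
      have "(0, False) \<in> V" "(2 * k - 1, True) \<in> V"
        using l by (auto simp: V_def)
      moreover have "a (0, False) = 0" "a (2 * k - 1, True) = 2 * k + l"
        using l by (auto simp: a_def gap_def)
      then have "c \<in> {a (0, False)..<a (0, False) + 4 * k} \<or>
          c \<in> {a (2 * k - 1, True)..<a (2 * k - 1, True) + 4 * k}"
        using c l by auto
      ultimately show "c \<in> (\<Union>x\<in>V. {a x..<a x + 4 * k})" by blast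
    qed
  qed
  then show ?thesis
    by (rule has_interval_arrayI) (simp_all add: V_def)
qed

section \<open>All even orders, by induction on \<open>n\<close>\<close>

lemma has_interval_array_even:
  assumes "0 < n" "3 * n \<le> t" "t < 4 * n"
  shows "has_interval_array (2 * n) t"
  using assms
proof (induction n arbitrary: t rule: less_induct)
  case (less n)
  have double: "has_interval_array (2 * n) t" if "has_interval_array n (t - 2 * n)"
    using has_interval_array_double[OF that] less.prems by simp
  show ?case
  proof (cases "odd n")
    case True
    then show ?thesis
      using double has_interval_array_odd[of n "t - 2 * n"] less.prems by simp
  next
    case False
    then obtain k where k: "n = 2 * k" by blast
    show ?thesis
    \<comment> \<open>The induction hypothesis for \<open>k\<close> colors needs
      \<open>3 * k \<le> t - 4 * k\<close>.\<close>
    proof (cases "t < 7 * k")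
      case True
      then show ?thesis
        using has_interval_array_short[of "t - 6 * k" k] less.prems k by simp
    next
      case False
      then show ?thesis
        using double less.IH[of k "t - 4 * k"] less.prems k by simp
    qed
  qed
qed

section \<open>From arrays to total colorings\<close>

lemma complete_digraph_interval_total_colorable:
  fixes G :: "('a, 'b) pre_digraph"
  assumes G: "K\<^bsub>m\<^esub> G" and m: "0 < m" and arr: "has_interval_array m t"
  shows "G \<in> \<TT>\<^bsub>t\<^esub>"
proof -
  interpret graph G using G by (simp add: complete_digraph_def)
  let ?V = "verts G"
  have card: "card ?V = m" and adj: "u \<rightarrow>\<^bsub>G\<^esub> v \<longleftrightarrow> u \<in> ?V \<and> v \<in> ?V \<and> u \<noteq> v" for u v
    using G by (auto simp: complete_digraph_def)
  obtain a M where M: "interval_array ?V a t M"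
    using has_interval_arrayE[OF arr finite_verts card] .
  have sym: "M u v = M v u" if "u \<in> ?V" "v \<in> ?V" for u v
    using M that by (auto simp: interval_array_def)
  have inj: "v = w" if "M u v = M u w" "u \<in> ?V" "v \<in> ?V" "w \<in> ?V" for u v w
    using M that by (auto simp: interval_array_def inj_on_def)
  have diag: "u = v" if "M u u = M v v" "u \<in> ?V" "v \<in> ?V" for u v
    using M that by (auto simp: interval_array_def inj_on_def)
  have row: "M u ` ?V = {a u..<a u + m}" if "u \<in> ?V" for u
    using interval_array_row[OF M finite_verts that] card by simp
  define \<alpha> where "\<alpha> u = Suc (M u u)" for u
  \<comment> \<open>An edge is an unordered pair; symmetry of \<open>M\<close> makes the choice of
    its ends irrelevant.\<close>
  define \<beta> where "\<beta> e = (SOME c. \<exists>u v. u \<in> ?V \<and> v \<in> ?V \<and> e = {u, v} \<and> c = Suc (M u v))" for e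
  have \<beta>: "\<beta> {u, v} = Suc (M u v)" if "u \<in> ?V" "v \<in> ?V" for u v
    unfolding \<beta>_def
  proof (rule some_equality)
    fix c assume "\<exists>u' v'. u' \<in> ?V \<and> v' \<in> ?V \<and> {u, v} = {u', v'} \<and> c = Suc (M u' v')"
    then show "c = Suc (M u v)"
      using sym by (auto simp: doubleton_eq_iff)
  qed (use that in blast)
  have edges: "uedges G = {{u, v} | u v. u \<in> ?V \<and> v \<in> ?V \<and> u \<noteq> v}"
    by (simp add: uedges_def adj)
  have inc: "incident_uedges G u = (\<lambda>v. {u, v}) ` (?V - {u})" if "u \<in> ?V" for u
    using that by (auto simp: incident_uedges_def edges)
  have deg: "udegree G u + 1 = m" if "u \<in> ?V" for u
  proof -
    have "inj_on (\<lambda>v. {u, v}) (?V - {u})"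
      by (auto simp: inj_on_def doubleton_eq_iff)
    then show ?thesis
      using that m by (simp add: udegree_def inc card_image card)
  qed
  have spec: "insert (\<alpha> u) (\<beta> ` incident_uedges G u) = {Suc (a u)..<Suc (a u) + m}" if "u \<in> ?V" for u
  proof -
    have "insert (\<alpha> u) (\<beta> ` incident_uedges G u) = Suc ` M u ` ?V"
      using that by (auto simp: inc \<beta> \<alpha>_def image_image)
    then show ?thesis
      using that by (simp add: row)
  qed
  have "total_coloring G \<alpha> \<beta>"
    unfolding total_coloring_def
  proof (intro conjI allI ballI impI)
    fix u v assume "u \<rightarrow>\<^bsub>G\<^esub> v"
    then show "\<alpha> u \<noteq> \<alpha> v"
      using diag by (auto simp: adj \<alpha>_def)
  next
    fix e f assume e: "e \<in> uedges G" and f: "f \<in> uedges G" and ef: "e \<noteq> f \<and> e \<inter> f \<noteq> {}"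
    then obtain u where u: "u \<in> e" "u \<in> f" by blast
    then have "u \<in> ?V" using e by (auto simp: edges)
    have "e \<in> incident_uedges G u" "f \<in> incident_uedges G u"
      using e f u by (auto simp: incident_uedges_def)
    then obtain v w where "e = {u, v}" "f = {u, w}" "v \<in> ?V" "w \<in> ?V"
      unfolding inc[OF \<open>u \<in> ?V\<close>] by blast
    then show "\<beta> e \<noteq> \<beta> f"
      using ef inj \<beta> \<open>u \<in> ?V\<close> by auto
  next
    fix u e assume "u \<in> ?V" "e \<in> incident_uedges G u"
    then obtain v where "v \<in> ?V" "v \<noteq> u" "e = {u, v}"
      by (auto simp: inc)
    then show "\<alpha> u \<noteq> \<beta> e"
      using inj[of u u v] \<open>u \<in> ?V\<close> by (auto simp: \<alpha>_def \<beta>)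
  qed
  moreover have "\<alpha> ` ?V \<union> \<beta> ` uedges G = {1..t}"
  proof -
    \<comment> \<open>Collecting colors vertex by vertex reduces the claim to the union of the
      intervals, shifted by one.\<close>
    have "uedges G = (\<Union>u\<in>?V. incident_uedges G u)"
      by (auto simp: incident_uedges_def edges)
    then have "\<alpha> ` ?V \<union> \<beta> ` uedges G = (\<Union>u\<in>?V. insert (\<alpha> u) (\<beta> ` incident_uedges G u))"
      by blast
    also have "\<dots> = (\<Union>u\<in>?V. Suc ` {a u..<a u + m})"
      by (simp add: spec)
    also have "\<dots> = Suc ` (\<Union>u\<in>?V. {a u..<a u + m})"
      by blast
    also have "(\<Union>u\<in>?V. {a u..<a u + m}) = {..<t}"
      using M by (simp add: interval_array_def card)
    finally show ?thesis
      by (simp add: lessThan_atLeast0 atLeastLessThanSuc_atLeastAtMost)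
  qed
  moreover have "0 < t"
  proof -
    have "?V \<noteq> {}" using card m by auto
    then obtain u where "u \<in> ?V" by blast
    then have "a u \<in> (\<Union>u\<in>?V. {a u..<a u + m})" using m by force
    also have "\<dots> = {..<t}"
      using M by (simp add: interval_array_def card)
    finally show ?thesis by auto
  qed
  ultimately show ?thesis
    unfolding interval_total_colorable_def interval_total_coloring_def
    using graph_axioms spec deg by blast
qed

theorem theorem11:
  fixes n :: nat
  assumes "n \<ge> 1"
  shows "(\<forall>t (G :: ('a, 'b) pre_digraph).
            2 * n - 1 \<le> t \<and> t \<le> 4 * n - 3 \<and> K\<^bsub>2 * n - 1\<^esub> G \<longrightarrow> G \<in> \<TT>\<^bsub>t\<^esub>) \<and>
         (\<forall>t (G :: ('a, 'b) pre_digraph).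
            3 * n \<le> t \<and> t \<le> 4 * n - 1 \<and> K\<^bsub>2 * n\<^esub> G \<longrightarrow> G \<in> \<TT>\<^bsub>t\<^esub>)"
proof (intro conjI allI impI; elim conjE)
  fix t and G :: "('a, 'b) pre_digraph"
  assume t: "2 * n - 1 \<le> t" "t \<le> 4 * n - 3" and G: "K\<^bsub>2 * n - 1\<^esub> G"
  have "has_interval_array (2 * n - 1) t"
    using t assms by (intro has_interval_array_odd) auto
  then show "G \<in> \<TT>\<^bsub>t\<^esub>"
    using complete_digraph_interval_total_colorable[OF G] assms by simp
next
  fix t and G :: "('a, 'b) pre_digraph"
  assume t: "3 * n \<le> t" "t \<le> 4 * n - 1" and G: "K\<^bsub>2 * n\<^esub> G"
  have "has_interval_array (2 * n) t"
    using t assms by (intro has_interval_array_even) auto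
  then show "G \<in> \<TT>\<^bsub>t\<^esub>"
    using complete_digraph_interval_total_colorable[OF G] assms by simp
qed

end
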